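(* The variety $\mathsf{ImpBiLat}$ of implicative bilattices is generated by the four-element implicative bilattice $\mathcal{FOUR}_\supset$. As a consequence, $\mathbf{Alg}^{*}\mathcal{LB}_\supset=V(\mathcal{FOUR}_\supset)$.
   Context: A bilattice is an algebra $\langle B,\land,\lor,\otimes,\oplus,\neg\rangle$ such that $\langle B,\land,\lor\rangle$ and $\langle B,\otimes,\oplus\rangle$ are lattices (not necessarily bounded) with orders $\leq_t$ and $\leq_k$, and $\neg$ is unary with: $a\leq_t b\Rightarrow\neg b\leq_t\neg a$; $a\leq_k b\Rightarrow\neg a\leq_k\neg b$; $\neg\neg a=a$. An implicative bilattice is an algebra $\langle B,\land,\lor,\otimes,\oplus,\supset,\neg\rangle$ whose $\supset$-free reduct is a bilattice and which satisfies: (IB1) $(x\supset x)\supset y\approx y$; (IB2) $x\supset(y\supset z)\approx(x\land y)\supset z\approx(x\otimes y)\supset z$; (IB3) $((x\supset y)\supset x)\supset x\approx x\supset x$; (IB4) $(x\lor y)\supset z\approx(x\supset z)\land(y\supset z)\approx(x\oplus y)\supset z$; (IB5) $x\land((x\supset y)\supset(x\otimes y))\approx x$; (IB6) $\neg(x\supset y)\supset z\approx(x\land\neg y)\supset z$. $\mathcal{FOUR}_\supset$ has universe $\{\mathsf f,\bot,\top,\mathsf t\}$ with $\mathsf f<_t\bot,\top<_t\mathsf t$ ($\bot,\top$ $\leq_t$-incomparable), $\bot<_k\mathsf f,\mathsf t<_k\top$ ($\mathsf f,\mathsf t$ $\leq_k$-incomparable), $\neg\mathsf f=\mathsf t$,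 $\neg\mathsf t=\mathsf f$, $\neg\bot=\bot$, $\neg\top=\top$, and $a\supset b=b$ if $a\in\mathsf{Tr}=\{\top,\mathsf t\}$, $a\supset b=\mathsf t$ otherwise. $V(\cdot)$ denotes the generated variety. $\mathcal{LB}_\supset$ is the logic in the language $\{\land,\lor,\otimes,\oplus,\supset,\neg\}$ (formula algebra $\mathbf{Fm}$ over countably many variables) determined by the matrix $\langle\mathcal{FOUR}_\supset,\mathsf{Tr}\rangle$: $\Gamma\vdash\varphi$ iff for every homomorphism $h:\mathbf{Fm}\to\mathcal{FOUR}_\supset$, $h[\Gamma]\subseteq\mathsf{Tr}$ implies $h(\varphi)\in\mathsf{Tr}$. A matrix $\langle\mathbf A,F\rangle$ is a model of the logic if $\Gamma\vdash\varphi$ and $h[\Gamma]\subseteq F$ imply $h(\varphi)\in F$ for all homomorphisms $h:\mathbf{Fm}\to\mathbf A$; it is reduced if the greatest congruence of $\mathbf A$ compatible with $F$ (not relating elements of $F$ to elements outside $F$) is the identity. $\mathbf{Alg}^*\mathcal{LB}_\supset$ is the class of algebraic reducts of the reduced models of $\mathcal{LB}_\supset$. *)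

theory Defs
  imports Main
begin

section \<open>Algebras in the language of implicative bilattices\<close>

record 'a ib_algebra =
  carrier :: "'a set"
  meet :: "'a \<Rightarrow> 'a \<Rightarrow> 'a"  (infixl "\<sqinter>\<index>" 70)
  join :: "'a \<Rightarrow> 'a \<Rightarrow> 'a"  (infixl "\<squnion>\<index>" 65)
  tensor :: "'a \<Rightarrow> 'a \<Rightarrow> 'a"  (infixl "\<otimes>\<index>" 70)
  plus :: "'a \<Rightarrow> 'a \<Rightarrow> 'a"  (infixl "\<oplus>\<index>" 65)
  imp :: "'a \<Rightarrow> 'a \<Rightarrow> 'a"  (infixr "\<rightarrow>\<index>" 60)
  neg :: "'a \<Rightarrow> 'a"  ("\<sim>\<index> _" [81] 80)

text \<open>As usual in universal algebra, the universe of an algebra is nonempty. The values of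
  the operations outside the universe are irrelevant.\<close>

locale ib_algebra =
  fixes A (structure)
  assumes nonempty: "carrier A \<noteq> {}"
    and meet_closed: "\<lbrakk>x \<in> carrier A; y \<in> carrier A\<rbrakk> \<Longrightarrow> x \<sqinter> y \<in> carrier A"
    and join_closed: "\<lbrakk>x \<in> carrier A; y \<in> carrier A\<rbrakk> \<Longrightarrow> x \<squnion> y \<in> carrier A"
    and tensor_closed: "\<lbrakk>x \<in> carrier A; y \<in> carrier A\<rbrakk> \<Longrightarrow> x \<otimes> y \<in> carrier A"
    and plus_closed: "\<lbrakk>x \<in> carrier A; y \<in> carrier A\<rbrakk> \<Longrightarrow> x \<oplus> y \<in> carrier A"
    and imp_closed: "\<lbrakk>x \<in> carrier A; y \<in> carrier A\<rbrakk> \<Longrightarrow> x \<rightarrow> y \<in> carrier A"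
    and neg_closed: "x \<in> carrier A \<Longrightarrow> \<sim> x \<in> carrier A"

definition hom :: "'a ib_algebra \<Rightarrow> 'b ib_algebra \<Rightarrow> ('a \<Rightarrow> 'b) set" where
  "hom A B = {h. h ` carrier A \<subseteq> carrier B \<and>
     (\<forall>x\<in>carrier A. \<forall>y\<in>carrier A.
        h (x \<sqinter>\<^bsub>A\<^esub> y) = h x \<sqinter>\<^bsub>B\<^esub> h y \<and>
        h (x \<squnion>\<^bsub>A\<^esub> y) = h x \<squnion>\<^bsub>B\<^esub> h y \<and>
        h (x \<otimes>\<^bsub>A\<^esub> y) = h x \<otimes>\<^bsub>B\<^esub> h y \<and>
        h (x \<oplus>\<^bsub>A\<^esub> y) = h x \<oplus>\<^bsub>B\<^esub> h y \<and>
        h (x \<rightarrow>\<^bsub>A\<^esub> y) = h x \<rightarrow>\<^bsub>B\<^esub> h y) \<and>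
     (\<forall>x\<in>carrier A. h (\<sim>\<^bsub>A\<^esub> x) = \<sim>\<^bsub>B\<^esub> h x)}"

definition congruence :: "'a ib_algebra \<Rightarrow> ('a \<times> 'a) set \<Rightarrow> bool" where
  "congruence A \<theta> \<longleftrightarrow> equiv (carrier A) \<theta> \<and>
     (\<forall>a b c d. (a, b) \<in> \<theta> \<and> (c, d) \<in> \<theta> \<longrightarrow>
        (a \<sqinter>\<^bsub>A\<^esub> c, b \<sqinter>\<^bsub>A\<^esub> d) \<in> \<theta> \<and>
        (a \<squnion>\<^bsub>A\<^esub> c, b \<squnion>\<^bsub>A\<^esub> d) \<in> \<theta> \<and>
        (a \<otimes>\<^bsub>A\<^esub> c, b \<otimes>\<^bsub>A\<^esub> d) \<in> \<theta> \<and>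
        (a \<oplus>\<^bsub>A\<^esub> c, b \<oplus>\<^bsub>A\<^esub> d) \<in> \<theta> \<and>
        (a \<rightarrow>\<^bsub>A\<^esub> c, b \<rightarrow>\<^bsub>A\<^esub> d) \<in> \<theta>) \<and>
     (\<forall>a b. (a, b) \<in> \<theta> \<longrightarrow> (\<sim>\<^bsub>A\<^esub> a, \<sim>\<^bsub>A\<^esub> b) \<in> \<theta>)"

section \<open>Implicative bilattices\<close>

text \<open>Lattices are taken as algebras, not as orders, because a bilattice carries two of them
  on one universe; the order of each is the usual one, given by its meet.\<close>

definition lattice_on :: "'a set \<Rightarrow> ('a \<Rightarrow> 'a \<Rightarrow> 'a) \<Rightarrow> ('a \<Rightarrow> 'a \<Rightarrow> 'a) \<Rightarrow> bool" where
  "lattice_on L m j \<longleftrightarrow>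
     (\<forall>x\<in>L. \<forall>y\<in>L. m x y \<in> L \<and> j x y \<in> L) \<and>
     (\<forall>x\<in>L. \<forall>y\<in>L. m x y = m y x \<and> j x y = j y x) \<and>
     (\<forall>x\<in>L. \<forall>y\<in>L. \<forall>z\<in>L. m (m x y) z = m x (m y z) \<and> j (j x y) z = j x (j y z)) \<and>
     (\<forall>x\<in>L. \<forall>y\<in>L. m x (j x y) = x \<and> j x (m x y) = x)"

definition le_t :: "'a ib_algebra \<Rightarrow> 'a \<Rightarrow> 'a \<Rightarrow> bool"  (infix "\<sqsubseteq>\<^sub>t\<index>" 50) where
  "x \<sqsubseteq>\<^sub>t\<^bsub>B\<^esub> y \<longleftrightarrow> x \<sqinter>\<^bsub>B\<^esub> y = x"

definition le_k :: "'a ib_algebra \<Rightarrow> 'a \<Rightarrow> 'a \<Rightarrow> bool"  (infix "\<sqsubseteq>\<^sub>k\<index>" 50) where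
  "x \<sqsubseteq>\<^sub>k\<^bsub>B\<^esub> y \<longleftrightarrow> x \<otimes>\<^bsub>B\<^esub> y = x"

text \<open>The operation \<open>imp\<close> plays no role here: this locale describes the reduct.\<close>

locale bilattice =
  fixes B (structure)
  assumes lattice_t: "lattice_on (carrier B) (meet B) (join B)"
    and lattice_k: "lattice_on (carrier B) (tensor B) (plus B)"
    and neg_le_t: "\<lbrakk>a \<in> carrier B; b \<in> carrier B; a \<sqsubseteq>\<^sub>t b\<rbrakk> \<Longrightarrow> \<sim> b \<sqsubseteq>\<^sub>t \<sim> a"
    and neg_le_k: "\<lbrakk>a \<in> carrier B; b \<in> carrier B; a \<sqsubseteq>\<^sub>k b\<rbrakk> \<Longrightarrow> \<sim> a \<sqsubseteq>\<^sub>k \<sim> b"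
    and neg_neg: "a \<in> carrier B \<Longrightarrow> \<sim> (\<sim> a) = a"

locale implicative_bilattice = ib_algebra B + bilattice B for B (structure) +
  assumes IB1: "\<lbrakk>x \<in> carrier B; y \<in> carrier B\<rbrakk> \<Longrightarrow> (x \<rightarrow> x) \<rightarrow> y = y"
    and IB2_meet: "\<lbrakk>x \<in> carrier B; y \<in> carrier B; z \<in> carrier B\<rbrakk>
      \<Longrightarrow> x \<rightarrow> (y \<rightarrow> z) = (x \<sqinter> y) \<rightarrow> z"
    and IB2_tensor: "\<lbrakk>x \<in> carrier B; y \<in> carrier B; z \<in> carrier B\<rbrakk>
      \<Longrightarrow> (x \<sqinter> y) \<rightarrow> z = (x \<otimes> y) \<rightarrow> z"
    and IB3: "\<lbrakk>x \<in> carrier B; y \<in> carrier B\<rbrakk> \<Longrightarrow> ((x \<rightarrow> y) \<rightarrow> x) \<rightarrow> x = x \<rightarrow> x"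
    and IB4_join: "\<lbrakk>x \<in> carrier B; y \<in> carrier B; z \<in> carrier B\<rbrakk>
      \<Longrightarrow> (x \<squnion> y) \<rightarrow> z = (x \<rightarrow> z) \<sqinter> (y \<rightarrow> z)"
    and IB4_plus: "\<lbrakk>x \<in> carrier B; y \<in> carrier B; z \<in> carrier B\<rbrakk>
      \<Longrightarrow> (x \<rightarrow> z) \<sqinter> (y \<rightarrow> z) = (x \<oplus> y) \<rightarrow> z"
    and IB5: "\<lbrakk>x \<in> carrier B; y \<in> carrier B\<rbrakk> \<Longrightarrow> x \<sqinter> ((x \<rightarrow> y) \<rightarrow> (x \<otimes> y)) = x"
    and IB6: "\<lbrakk>x \<in> carrier B; y \<in> carrier B; z \<in> carrier B\<rbrakk>
      \<Longrightarrow> \<sim> (x \<rightarrow> y) \<rightarrow> z = (x \<sqinter> \<sim> y) \<rightarrow> z"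

definition ImpBiLat :: "'a ib_algebra set" where
  "ImpBiLat = {B. implicative_bilattice B}"

section \<open>Formulas, equations and generated varieties\<close>

datatype fm =
    Var nat
  | Meet fm fm
  | Join fm fm
  | Tensor fm fm
  | Plus fm fm
  | Imp fm fm
  | Neg fm

definition Fm :: "fm ib_algebra" where
  "Fm = \<lparr>carrier = UNIV, meet = Meet, join = Join, tensor = Tensor, plus = Plus,
         imp = Imp, neg = Neg\<rparr>"

text \<open>The class of algebras on a given type axiomatized by a set of equations.\<close>

definition equational_class :: "(fm \<times> fm) set \<Rightarrow> 'a ib_algebra set" where
  "equational_class E = {A. ib_algebra A \<and> (\<forall>(\<phi>, \<psi>)\<in>E. \<forall>h\<in>hom Fm A. h \<phi> = h \<psi>)}"

text \<open>Varieties are equational classes, and the variety generated by \<open>K\<close> is the least one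
  containing \<open>K\<close>. An equational class has members on every type, so the type \<open>'a\<close> of the
  members considered need not be the type \<open>'b\<close> of the generators.\<close>

definition V :: "'b ib_algebra set \<Rightarrow> 'a ib_algebra set" where
  "V K = \<Inter> {equational_class E | E. K \<subseteq> equational_class E}"

section \<open>The four-element implicative bilattice\<close>

datatype four = F_ff | F_bot | F_top | F_tt

definition four_le_t :: "four \<Rightarrow> four \<Rightarrow> bool" where
  "four_le_t x y \<longleftrightarrow> x = y \<or> x = F_ff \<or> y = F_tt"

definition four_le_k :: "four \<Rightarrow> four \<Rightarrow> bool" where
  "four_le_k x y \<longleftrightarrow> x = y \<or> x = F_bot \<or> y = F_top"

definition Tr :: "four set" where
  "Tr = {F_top, F_tt}"

fun four_neg :: "four \<Rightarrow> four" where
  "four_neg F_ff = F_tt"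
| "four_neg F_tt = F_ff"
| "four_neg F_bot = F_bot"
| "four_neg F_top = F_top"

text \<open>The lattice operations are the infima and suprema of the two orders, as confirmed
  below.\<close>

definition FOUR :: "four ib_algebra" where
  "FOUR = \<lparr>carrier = UNIV,
     meet = (\<lambda>x y. if four_le_t x y then x else if four_le_t y x then y else F_ff),
     join = (\<lambda>x y. if four_le_t x y then y else if four_le_t y x then x else F_tt),
     tensor = (\<lambda>x y. if four_le_k x y then x else if four_le_k y x then y else F_bot),
     plus = (\<lambda>x y. if four_le_k x y then y else if four_le_k y x then x else F_top),
     imp = (\<lambda>a b. if a \<in> Tr then b else F_tt),
     neg = four_neg\<rparr>"

lemma four_t_bounds:
  "four_le_t z (x \<sqinter>\<^bsub>FOUR\<^esub> y) \<longleftrightarrow> four_le_t z x \<and> four_le_t z y"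
  "four_le_t (x \<squnion>\<^bsub>FOUR\<^esub> y) z \<longleftrightarrow> four_le_t x z \<and> four_le_t y z"
  by (cases x; cases y; cases z; simp add: FOUR_def four_le_t_def)+

lemma four_k_bounds:
  "four_le_k z (x \<otimes>\<^bsub>FOUR\<^esub> y) \<longleftrightarrow> four_le_k z x \<and> four_le_k z y"
  "four_le_k (x \<oplus>\<^bsub>FOUR\<^esub> y) z \<longleftrightarrow> four_le_k x z \<and> four_le_k y z"
  by (cases x; cases y; cases z; simp add: FOUR_def four_le_k_def)+

lemma all_four: "(\<forall>x. P x) \<longleftrightarrow> P F_ff \<and> P F_bot \<and> P F_top \<and> P F_tt"
  by (metis four.exhaust)

lemma FOUR_ImpBiLat: "FOUR \<in> ImpBiLat"
proof -
  have "lattice_on (carrier FOUR) (meet FOUR) (join FOUR)"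
       "lattice_on (carrier FOUR) (tensor FOUR) (plus FOUR)"
    unfolding lattice_on_def
    by (simp_all add: FOUR_def all_four four_le_t_def four_le_k_def)
  then have "implicative_bilattice FOUR"
    apply unfold_locales
    subgoal by (simp add: FOUR_def)
    subgoal by (simp add: FOUR_def)
    subgoal by (simp add: FOUR_def)
    subgoal by (simp add: FOUR_def)
    subgoal by (simp add: FOUR_def)
    subgoal by (simp add: FOUR_def)
    subgoal by (simp add: FOUR_def)
    subgoal by assumption
    subgoal by assumption
    subgoal for x y by (cases x; cases y; simp add: FOUR_def le_t_def four_le_t_def)
    subgoal for x y by (cases x; cases y; simp add: FOUR_def le_k_def four_le_k_def)
    subgoal for x by (cases x; simp add: FOUR_def)
    subgoal for x y by (cases x; simp add: FOUR_def Tr_def)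
    subgoal for x y z by (cases x; cases y; simp add: FOUR_def Tr_def four_le_t_def)
    subgoal for x y z by (cases x; cases y; simp add: FOUR_def Tr_def four_le_t_def four_le_k_def)
    subgoal for x y by (cases x; cases y; simp add: FOUR_def Tr_def)
    subgoal for x y z by (cases x; cases y; cases z; simp add: FOUR_def Tr_def four_le_t_def)
    subgoal for x y z
      by (cases x; cases y; cases z; simp add: FOUR_def Tr_def four_le_t_def four_le_k_def)
    subgoal for x y by (cases x; cases y; simp add: FOUR_def Tr_def four_le_t_def four_le_k_def)
    subgoal for x y z by (cases x; cases y; simp add: FOUR_def Tr_def four_le_t_def)
    done
  then show ?thesis by (simp add: ImpBiLat_def)
qed

section \<open>The logic, its matrix models and their algebraic reducts\<close>

definition LB_entails :: "fm set \<Rightarrow> fm \<Rightarrow> bool"  (infix "\<turnstile>\<^sub>L\<^sub>B" 50) where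
  "\<Gamma> \<turnstile>\<^sub>L\<^sub>B \<phi> \<longleftrightarrow> (\<forall>h\<in>hom Fm FOUR. h ` \<Gamma> \<subseteq> Tr \<longrightarrow> h \<phi> \<in> Tr)"

definition is_matrix :: "'a ib_algebra \<Rightarrow> 'a set \<Rightarrow> bool" where
  "is_matrix A F \<longleftrightarrow> ib_algebra A \<and> F \<subseteq> carrier A"

definition LB_model :: "'a ib_algebra \<Rightarrow> 'a set \<Rightarrow> bool" where
  "LB_model A F \<longleftrightarrow> is_matrix A F \<and>
     (\<forall>\<Gamma> \<phi>. \<Gamma> \<turnstile>\<^sub>L\<^sub>B \<phi> \<longrightarrow> (\<forall>h\<in>hom Fm A. h ` \<Gamma> \<subseteq> F \<longrightarrow> h \<phi> \<in> F))"

definition compatible_congruence :: "'a ib_algebra \<Rightarrow> 'a set \<Rightarrow> ('a \<times> 'a) set \<Rightarrow> bool" where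
  "compatible_congruence A F \<theta> \<longleftrightarrow>
     congruence A \<theta> \<and> (\<forall>(a, b)\<in>\<theta>. a \<in> F \<longleftrightarrow> b \<in> F)"

definition greatest_compatible_congruence ::
    "'a ib_algebra \<Rightarrow> 'a set \<Rightarrow> ('a \<times> 'a) set \<Rightarrow> bool" where
  "greatest_compatible_congruence A F \<theta> \<longleftrightarrow>
     compatible_congruence A F \<theta> \<and> (\<forall>\<theta>'. compatible_congruence A F \<theta>' \<longrightarrow> \<theta>' \<subseteq> \<theta>)"

definition reduced :: "'a ib_algebra \<Rightarrow> 'a set \<Rightarrow> bool" where
  "reduced A F \<longleftrightarrow> greatest_compatible_congruence A F (Id_on (carrier A))"

definition Alg_star_LB :: "'a ib_algebra set" where
  "Alg_star_LB = {A. \<exists>F. LB_model A F \<and> reduced A F}"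

end

theory Submission
  imports Defs
begin

text \<open>
  The proof separates the points of an implicative bilattice \<open>B\<close> by homomorphisms into
  \<open>FOUR\<close>. In \<open>B\<close>, the set \<open>F\<close> of those \<open>a\<close> for which \<open>a \<rightarrow> _\<close> is the identity contains the
  theorems of positive classical logic and is closed under modus ponens. For a maximal such
  set \<open>D\<close> avoiding a given element, membership of \<open>a\<close> and of \<open>\<sim> a\<close> in \<open>D\<close> are the two bits of
  a homomorphism into \<open>FOUR\<close>. The points are separated because IB5 turns \<open>a \<rightarrow> b \<in> F\<close> into
  \<open>a \<sqsubseteq>\<^sub>t a \<otimes> b\<close>: if \<open>a \<rightarrow> b\<close>, \<open>b \<rightarrow> a\<close>, \<open>\<sim> a \<rightarrow> \<sim> b\<close>, \<open>\<sim> b \<rightarrow> \<sim> a\<close> are all in \<open>F\<close>, then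
  \<open>a \<otimes> b\<close> lies above \<open>a\<close> and \<open>b\<close>, and \<open>\<sim> (a \<otimes> b)\<close> above \<open>\<sim> a\<close> and \<open>\<sim> b\<close>, so \<open>a = a \<otimes> b = b\<close>.
  The conjunction of these four implications is an equality test in \<open>FOUR\<close>, so in every model
  of the logic it defines the greatest compatible congruence.
\<close>

section \<open>Lattices and homomorphisms\<close>

lemma lattice_onD:
  assumes "lattice_on L m j"
  shows "\<And>x y. \<lbrakk>x \<in> L; y \<in> L\<rbrakk> \<Longrightarrow> m x y \<in> L" "\<And>x y. \<lbrakk>x \<in> L; y \<in> L\<rbrakk> \<Longrightarrow> j x y \<in> L"
    "\<And>x y. \<lbrakk>x \<in> L; y \<in> L\<rbrakk> \<Longrightarrow> m x y = m y x" "\<And>x y. \<lbrakk>x \<in> L; y \<in> L\<rbrakk> \<Longrightarrow> j x y = j y x"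
    "\<And>x y z. \<lbrakk>x \<in> L; y \<in> L; z \<in> L\<rbrakk> \<Longrightarrow> m (m x y) z = m x (m y z)"
    "\<And>x y z. \<lbrakk>x \<in> L; y \<in> L; z \<in> L\<rbrakk> \<Longrightarrow> j (j x y) z = j x (j y z)"
    "\<And>x y. \<lbrakk>x \<in> L; y \<in> L\<rbrakk> \<Longrightarrow> m x (j x y) = x" "\<And>x y. \<lbrakk>x \<in> L; y \<in> L\<rbrakk> \<Longrightarrow> j x (m x y) = x"
  using assms unfolding lattice_on_def by blast+

lemma lattice_on_dual: "lattice_on L m j \<Longrightarrow> lattice_on L j m"
  unfolding lattice_on_def by blast

lemma lattice_on_meet_idem: "\<lbrakk>lattice_on L m j; x \<in> L\<rbrakk> \<Longrightarrow> m x x = x"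
  by (metis lattice_onD(1,7,8))

lemma lattice_on_meet_iff_join:
  assumes L: "lattice_on L m j" and xy: "x \<in> L" "y \<in> L"
  shows "m x y = x \<longleftrightarrow> j x y = y"
proof
  note l = lattice_onD[OF L]
  show "j x y = y" if "m x y = x"
    using l(8)[of y x] l(3)[of y x] l(4)[of y x] xy that by simp
  show "m x y = x" if "j x y = y"
    using l(7)[OF xy] that by simp
qed

lemma lattice_on_meet_greatest:
  "\<lbrakk>lattice_on L m j; x \<in> L; y \<in> L; z \<in> L; m z x = z; m z y = z\<rbrakk> \<Longrightarrow> m z (m x y) = z"
  by (metis lattice_onD(5))

lemma lattice_on_meet_lower:
  assumes "lattice_on L m j" "x \<in> L" "y \<in> L"
  shows "m (m x y) x = m x y" "m (m x y) y = m x y"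
proof -
  note l = lattice_onD[OF assms(1)]
  show "m (m x y) x = m x y"
    using l(5)[of x x y] l(3)[of "m x y" x] l(1) lattice_on_meet_idem[OF assms(1,2)] assms(2,3)
    by simp
  show "m (m x y) y = m x y"
    using l(5)[of x y y] lattice_on_meet_idem[OF assms(1,3)] assms(2,3) by simp
qed

text \<open>Antitonicity at \<open>m x y\<close>, below \<open>x\<close> and \<open>y\<close>, puts
  the join below \<open>n (m x y)\<close>. Since \<open>n x\<close> and \<open>n y\<close> lie below
  their join, antitonicity also puts \<open>n\<close> of the join below \<open>m x y\<close>; one
  more \<open>n\<close> gives the converse.\<close>

lemma lattice_on_meet_antitone_involution:
  assumes L: "lattice_on L m j"
    and cl: "\<And>x. x \<in> L \<Longrightarrow> n x \<in> L" and inv: "\<And>x. x \<in> L \<Longrightarrow> n (n x) = x"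
    and anti: "\<And>x y. \<lbrakk>x \<in> L; y \<in> L; m x y = x\<rbrakk> \<Longrightarrow> m (n y) (n x) = n y"
    and x: "x \<in> L" and y: "y \<in> L"
  shows "n (m x y) = j (n x) (n y)"
proof -
  note l = lattice_onD[OF L]
  let ?u = "j (n x) (n y)" and ?v = "n (m x y)"
  have c: "n x \<in> L" "n y \<in> L" "m x y \<in> L" "?u \<in> L" "?v \<in> L" "n ?u \<in> L"
    using x y cl l(1,2) by auto
  have "m (n x) ?v = n x" "m (n y) ?v = n y"
    using anti x y c lattice_on_meet_lower[OF L x y] by metis+
  then have "j (n x) ?v = ?v" "j (n y) ?v = ?v"
    using lattice_on_meet_iff_join[OF L] c by auto
  then have "j ?u ?v = ?v" using l(6) c by metis
  have "m (n x) ?u = n x" "m (n y) ?u = n y" using l(7) l(4) c by metis+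
  then have "m (n ?u) x = n ?u" "m (n ?u) y = n ?u" using anti inv x y c by metis+
  then have "m (n ?u) (m x y) = n ?u" using lattice_on_meet_greatest[OF L x y] c by auto
  then have "m ?v (n (n ?u)) = ?v" using anti c by blast
  then have "m ?v ?u = ?v" using inv c by simp
  then have "j ?u ?v = ?u" using lattice_on_meet_iff_join[OF L] l(4) c by metis
  with \<open>j ?u ?v = ?v\<close> show ?thesis by simp
qed

text \<open>A monotone map sends a meet below the meet of the images. The same inequality at
  \<open>n x\<close> and \<open>n y\<close>, carried back by the involution, is the
  converse.\<close>

lemma lattice_on_meet_automorphism:
  assumes L: "lattice_on L m j"
    and cl: "\<And>x. x \<in> L \<Longrightarrow> n x \<in> L" and inv: "\<And>x. x \<in> L \<Longrightarrow> n (n x) = x"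
    and mono: "\<And>x y. \<lbrakk>x \<in> L; y \<in> L; m x y = x\<rbrakk> \<Longrightarrow> m (n x) (n y) = n x"
    and x: "x \<in> L" and y: "y \<in> L"
  shows "n (m x y) = m (n x) (n y)"
proof -
  note l = lattice_onD[OF L]
  have le: "m (n (m a b)) (m (n a) (n b)) = n (m a b)" if "a \<in> L" "b \<in> L" for a b
    using mono lattice_on_meet_lower[OF L that] lattice_on_meet_greatest[OF L] l(1) cl that
    by metis
  let ?u = "m (n x) (n y)"
  have c: "n x \<in> L" "n y \<in> L" "m x y \<in> L" "?u \<in> L" "n ?u \<in> L" "n (m x y) \<in> L"
    using x y cl l(1) by auto
  have "m (n ?u) (m x y) = n ?u" using le[of "n x" "n y"] c inv x y by simp
  then have "m ?u (n (m x y)) = ?u" using mono[of "n ?u" "m x y"] c inv by simp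
  then show ?thesis using le[OF x y] l(3) c by metis
qed

lemma ib_algebra_closed:
  assumes "ib_algebra A"
  shows "\<lbrakk>x \<in> carrier A; y \<in> carrier A\<rbrakk> \<Longrightarrow> x \<sqinter>\<^bsub>A\<^esub> y \<in> carrier A"
    "\<lbrakk>x \<in> carrier A; y \<in> carrier A\<rbrakk> \<Longrightarrow> x \<squnion>\<^bsub>A\<^esub> y \<in> carrier A"
    "\<lbrakk>x \<in> carrier A; y \<in> carrier A\<rbrakk> \<Longrightarrow> x \<otimes>\<^bsub>A\<^esub> y \<in> carrier A"
    "\<lbrakk>x \<in> carrier A; y \<in> carrier A\<rbrakk> \<Longrightarrow> x \<oplus>\<^bsub>A\<^esub> y \<in> carrier A"
    "\<lbrakk>x \<in> carrier A; y \<in> carrier A\<rbrakk> \<Longrightarrow> x \<rightarrow>\<^bsub>A\<^esub> y \<in> carrier A"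
    "x \<in> carrier A \<Longrightarrow> \<sim>\<^bsub>A\<^esub> x \<in> carrier A"
  using assms unfolding ib_algebra_def by auto

lemma homD:
  assumes "h \<in> hom A B"
  shows "x \<in> carrier A \<Longrightarrow> h x \<in> carrier B"
    "\<lbrakk>x \<in> carrier A; y \<in> carrier A\<rbrakk> \<Longrightarrow> h (x \<sqinter>\<^bsub>A\<^esub> y) = h x \<sqinter>\<^bsub>B\<^esub> h y"
    "\<lbrakk>x \<in> carrier A; y \<in> carrier A\<rbrakk> \<Longrightarrow> h (x \<squnion>\<^bsub>A\<^esub> y) = h x \<squnion>\<^bsub>B\<^esub> h y"
    "\<lbrakk>x \<in> carrier A; y \<in> carrier A\<rbrakk> \<Longrightarrow> h (x \<otimes>\<^bsub>A\<^esub> y) = h x \<otimes>\<^bsub>B\<^esub> h y"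
    "\<lbrakk>x \<in> carrier A; y \<in> carrier A\<rbrakk> \<Longrightarrow> h (x \<oplus>\<^bsub>A\<^esub> y) = h x \<oplus>\<^bsub>B\<^esub> h y"
    "\<lbrakk>x \<in> carrier A; y \<in> carrier A\<rbrakk> \<Longrightarrow> h (x \<rightarrow>\<^bsub>A\<^esub> y) = h x \<rightarrow>\<^bsub>B\<^esub> h y"
    "x \<in> carrier A \<Longrightarrow> h (\<sim>\<^bsub>A\<^esub> x) = \<sim>\<^bsub>B\<^esub> h x"
  using assms unfolding hom_def by auto

lemma hom_comp: "\<lbrakk>g \<in> hom A B; h \<in> hom C A\<rbrakk> \<Longrightarrow> g \<circ> h \<in> hom C B"
  unfolding hom_def by (auto simp: image_subset_iff)

section \<open>Deductive filters of implicative bilattices\<close>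

context implicative_bilattice
begin

lemmas closed = meet_closed join_closed tensor_closed plus_closed imp_closed neg_closed

section \<open>Action of the negation on the two lattices\<close>

lemma neg_meet: "\<lbrakk>x \<in> carrier B; y \<in> carrier B\<rbrakk> \<Longrightarrow> \<sim> (x \<sqinter> y) = \<sim> x \<squnion> \<sim> y"
  by (rule lattice_on_meet_antitone_involution[OF lattice_t])
    (auto simp: closed neg_neg neg_le_t[unfolded le_t_def])

lemma neg_tensor: "\<lbrakk>x \<in> carrier B; y \<in> carrier B\<rbrakk> \<Longrightarrow> \<sim> (x \<otimes> y) = \<sim> x \<otimes> \<sim> y"
  by (rule lattice_on_meet_automorphism[OF lattice_k])
    (auto simp: closed neg_neg neg_le_k[unfolded le_k_def])

lemma neg_join: "\<lbrakk>x \<in> carrier B; y \<in> carrier B\<rbrakk> \<Longrightarrow> \<sim> (x \<squnion> y) = \<sim> x \<sqinter> \<sim> y"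
  by (metis neg_meet neg_neg closed(1,6))

lemma neg_plus:
  assumes "x \<in> carrier B" "y \<in> carrier B"
  shows "\<sim> (x \<oplus> y) = \<sim> x \<oplus> \<sim> y"
\<comment> \<open>In the dual lattice \<open>\<oplus>\<close> is the meet; what remains is that
  \<open>\<sim>\<close> is monotone for the reversed knowledge order.\<close>
proof (rule lattice_on_meet_automorphism[OF lattice_on_dual[OF lattice_k]])
  fix x y assume xy: "x \<in> carrier B" "y \<in> carrier B" "x \<oplus> y = x"
  then have "y \<otimes> x = y"
    using lattice_on_meet_iff_join[OF lattice_k] lattice_onD(4)[OF lattice_k] by metis
  then have "\<sim> y \<otimes> \<sim> x = \<sim> y" using neg_le_k xy unfolding le_k_def by blast
  then show "\<sim> x \<oplus> \<sim> y = \<sim> x"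
    using lattice_on_meet_iff_join[OF lattice_k] lattice_onD(4)[OF lattice_k] xy closed(6)
    by metis
qed (use assms in \<open>auto simp: closed neg_neg\<close>)

text \<open>The set called \<open>F\<close> in the overview. It contains every
  \<open>x \<rightarrow> x\<close> by IB1, and each of its elements has this form because
  \<open>a \<rightarrow> a = a\<close>.\<close>

definition units :: "'a set" where
  "units = {a \<in> carrier B. \<forall>z\<in>carrier B. a \<rightarrow> z = z}"

lemma units_imp: "\<lbrakk>a \<in> units; z \<in> carrier B\<rbrakk> \<Longrightarrow> a \<rightarrow> z = z"
  by (auto simp: units_def)

section \<open>Positive classical calculus of the implication\<close>

lemma imp_commute:
  "\<lbrakk>x \<in> carrier B; y \<in> carrier B; z \<in> carrier B\<rbrakk> \<Longrightarrow> x \<rightarrow> (y \<rightarrow> z) = y \<rightarrow> (x \<rightarrow> z)"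
  by (metis IB2_meet lattice_onD(3)[OF lattice_t])

lemma imp_idem: "\<lbrakk>x \<in> carrier B; z \<in> carrier B\<rbrakk> \<Longrightarrow> x \<rightarrow> (x \<rightarrow> z) = x \<rightarrow> z"
  by (metis IB2_meet lattice_on_meet_idem[OF lattice_t])

lemma le_t_imp_imp:
  "\<lbrakk>x \<in> carrier B; y \<in> carrier B; z \<in> carrier B; x \<sqsubseteq>\<^sub>t y\<rbrakk> \<Longrightarrow> x \<rightarrow> (y \<rightarrow> z) = x \<rightarrow> z"
  by (metis IB2_meet le_t_def)

lemma units_up: "\<lbrakk>x \<in> units; y \<in> carrier B; x \<sqsubseteq>\<^sub>t y\<rbrakk> \<Longrightarrow> y \<in> units"
  unfolding units_def using le_t_imp_imp[of x y] closed(5)[of y] by auto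

lemma self_imp_units: "x \<in> carrier B \<Longrightarrow> x \<rightarrow> x \<in> units"
  by (auto simp: units_def closed IB1)

lemma le_t_imp_antitone:
  assumes "x \<in> carrier B" "y \<in> carrier B" "z \<in> carrier B" "x \<sqsubseteq>\<^sub>t y"
  shows "(y \<rightarrow> z) \<sqsubseteq>\<^sub>t (x \<rightarrow> z)"
proof -
  have "x \<squnion> y = y" using assms lattice_on_meet_iff_join[OF lattice_t] unfolding le_t_def by blast
  then have "y \<rightarrow> z = (x \<rightarrow> z) \<sqinter> (y \<rightarrow> z)" using IB4_join assms by metis
  then show ?thesis
    unfolding le_t_def using lattice_on_meet_lower(1)[OF lattice_t] assms closed by metis
qed

text \<open>The unit \<open>y \<rightarrow> y\<close> lies below \<open>x \<rightarrow> y\<close> by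
  antitonicity, and units are closed upwards.\<close>

lemma le_t_imp_units: "\<lbrakk>x \<in> carrier B; y \<in> carrier B; x \<sqsubseteq>\<^sub>t y\<rbrakk> \<Longrightarrow> x \<rightarrow> y \<in> units"
  by (meson le_t_imp_antitone self_imp_units units_up closed(5))

lemma imp_K:
  assumes "x \<in> carrier B" "y \<in> carrier B"
  shows "x \<rightarrow> (y \<rightarrow> x) \<in> units"
  using assms le_t_imp_units[of "x \<sqinter> y" x] lattice_on_meet_lower(1)[OF lattice_t]
  by (simp add: closed IB2_meet le_t_def)

lemma units_imp_le_t:
  assumes "x \<in> carrier B" "y \<in> carrier B" "x \<rightarrow> y \<in> units"
  shows "x \<sqsubseteq>\<^sub>t x \<otimes> y"
  using IB5[OF assms(1,2)] units_imp[OF assms(3)] assms closed unfolding le_t_def by metis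

text \<open>Here \<open>x\<close> lies below \<open>x \<otimes> y\<close>, so the antecedent
  \<open>x \<otimes> y\<close> is redundant under \<open>x\<close>. By IB2 that antecedent unfolds
  into \<open>x\<close> and \<open>y\<close>, and the repeated \<open>x\<close> contracts.\<close>

lemma units_imp_absorb:
  assumes "x \<in> carrier B" "y \<in> carrier B" "z \<in> carrier B" "x \<rightarrow> y \<in> units"
  shows "x \<rightarrow> (y \<rightarrow> z) = x \<rightarrow> z"
proof -
  have "x \<rightarrow> ((x \<otimes> y) \<rightarrow> z) = x \<rightarrow> z"
    using le_t_imp_imp units_imp_le_t assms closed by metis
  moreover have "(x \<otimes> y) \<rightarrow> z = x \<rightarrow> (y \<rightarrow> z)" using IB2_meet IB2_tensor assms by metis
  ultimately show ?thesis using imp_idem assms closed by metis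
qed

text \<open>Modus ponens among antecedents. For the meet \<open>?p\<close> of \<open>x\<close> and
  \<open>x \<rightarrow> y\<close>, the element \<open>?p \<rightarrow> y\<close> is a unit, so
  \<open>y\<close> may be added as an antecedent; under \<open>y\<close>, the antecedent
  \<open>x \<rightarrow> y\<close> is then redundant by \<open>imp_K\<close>.\<close>

lemma imp_detach:
  assumes "x \<in> carrier B" "y \<in> carrier B" "z \<in> carrier B"
  shows "x \<rightarrow> ((x \<rightarrow> y) \<rightarrow> z) = x \<rightarrow> (y \<rightarrow> z)"
proof -
  let ?p = "x \<sqinter> (x \<rightarrow> y)"
  have c: "x \<rightarrow> y \<in> carrier B" "?p \<in> carrier B" "y \<rightarrow> z \<in> carrier B" using assms closed by auto
  have "?p \<rightarrow> y = (x \<rightarrow> y) \<rightarrow> (x \<rightarrow> y)"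
    using IB2_meet imp_commute assms c by metis
  then have "?p \<rightarrow> (y \<rightarrow> z) = ?p \<rightarrow> z"
    using units_imp_absorb self_imp_units c assms by metis
  then have "x \<rightarrow> ((x \<rightarrow> y) \<rightarrow> z) = x \<rightarrow> ((x \<rightarrow> y) \<rightarrow> (y \<rightarrow> z))"
    using IB2_meet assms c by metis
  also have "\<dots> = x \<rightarrow> (y \<rightarrow> ((x \<rightarrow> y) \<rightarrow> z))" using imp_commute assms c by metis
  also have "\<dots> = x \<rightarrow> (y \<rightarrow> z)" using units_imp_absorb imp_K assms c by metis
  finally show ?thesis .
qed

text \<open>Frege's axiom as an equation, the source of the deduction theorem below.\<close>

lemma imp_distrib:
  assumes "x \<in> carrier B" "y \<in> carrier B" "z \<in> carrier B"
  shows "(x \<rightarrow> y) \<rightarrow> (x \<rightarrow> z) = x \<rightarrow> (y \<rightarrow> z)"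
  using imp_detach[OF assms] imp_commute[of "x \<rightarrow> y" x z] assms closed by metis

section \<open>Deductive sets\<close>

definition deductive :: "'a set \<Rightarrow> bool" where
  "deductive D \<longleftrightarrow> D \<subseteq> carrier B \<and> units \<subseteq> D \<and>
     (\<forall>x\<in>D. \<forall>y\<in>carrier B. x \<rightarrow> y \<in> D \<longrightarrow> y \<in> D)"

lemma deductive_mp: "\<lbrakk>deductive D; x \<in> D; y \<in> carrier B; x \<rightarrow> y \<in> D\<rbrakk> \<Longrightarrow> y \<in> D"
  unfolding deductive_def by blast

lemma deductive_unitsD: "\<lbrakk>deductive D; x \<in> units\<rbrakk> \<Longrightarrow> x \<in> D"
  by (auto simp: deductive_def)

lemma deductive_carrier: "\<lbrakk>deductive D; x \<in> D\<rbrakk> \<Longrightarrow> x \<in> carrier B"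
  by (auto simp: deductive_def)

lemma deductive_units: "deductive units"
  unfolding deductive_def using units_imp by (auto simp: units_def)

lemma deductive_up: "\<lbrakk>deductive D; x \<in> D; y \<in> carrier B; x \<rightarrow> y \<in> units\<rbrakk> \<Longrightarrow> y \<in> D"
  using deductive_mp deductive_unitsD by blast

lemma deductive_imp: "\<lbrakk>deductive D; y \<in> D; x \<in> carrier B\<rbrakk> \<Longrightarrow> x \<rightarrow> y \<in> D"
  using deductive_up imp_K deductive_carrier closed(5) by meson

text \<open>An algebraic deduction theorem: this is the deductive set generated by \<open>D\<close>
  and \<open>x\<close>. Closure under modus ponens is \<open>imp_distrib\<close>.\<close>

lemma deductive_extend:
  assumes D: "deductive D" and x: "x \<in> carrier B"
  shows "deductive {y \<in> carrier B. x \<rightarrow> y \<in> D}"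
  unfolding deductive_def
proof (intro conjI ballI impI subsetI)
  fix u assume "u \<in> units"
  then show "u \<in> {y \<in> carrier B. x \<rightarrow> y \<in> D}"
    using D x deductive_imp deductive_unitsD deductive_carrier by blast
next
  fix u v assume u: "u \<in> {y \<in> carrier B. x \<rightarrow> y \<in> D}" and v: "v \<in> carrier B"
    and uv: "u \<rightarrow> v \<in> {y \<in> carrier B. x \<rightarrow> y \<in> D}"
  then have "(x \<rightarrow> u) \<rightarrow> (x \<rightarrow> v) \<in> D" using imp_distrib x by auto
  then show "v \<in> {y \<in> carrier B. x \<rightarrow> y \<in> D}"
    using deductive_mp[OF D, of "x \<rightarrow> u" "x \<rightarrow> v"] u v x closed(5) by simp
qed auto

lemma deductive_meet_iff:
  assumes D: "deductive D" and xy: "x \<in> carrier B" "y \<in> carrier B"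
  shows "x \<sqinter> y \<in> D \<longleftrightarrow> x \<in> D \<and> y \<in> D"
proof
  assume m: "x \<sqinter> y \<in> D"
  show "x \<in> D \<and> y \<in> D"
    using deductive_up[OF D m] le_t_imp_units[unfolded le_t_def]
      lattice_on_meet_lower[OF lattice_t xy] xy closed by blast
next
  assume xD: "x \<in> D \<and> y \<in> D"
  have "x \<rightarrow> (y \<rightarrow> x \<sqinter> y) \<in> D"
    using self_imp_units[of "x \<sqinter> y"] IB2_meet xy closed deductive_unitsD[OF D] by metis
  then show "x \<sqinter> y \<in> D" using deductive_mp[OF D] xD xy closed by meson
qed

text \<open>IB2, IB4 and IB6 compare elements only as antecedents. This suffices for membership:
  \<open>x \<rightarrow> y\<close> equals the unit \<open>y \<rightarrow> y\<close>, and
  symmetrically.\<close>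

lemma deductive_cong:
  assumes D: "deductive D" and xy: "x \<in> carrier B" "y \<in> carrier B"
    and eq: "\<And>z. z \<in> carrier B \<Longrightarrow> x \<rightarrow> z = y \<rightarrow> z"
  shows "x \<in> D \<longleftrightarrow> y \<in> D"
  using deductive_up[OF D] self_imp_units eq xy by metis

lemma deductive_tensor_iff:
  "\<lbrakk>deductive D; x \<in> carrier B; y \<in> carrier B\<rbrakk> \<Longrightarrow> x \<otimes> y \<in> D \<longleftrightarrow> x \<in> D \<and> y \<in> D"
  using deductive_cong[of D "x \<sqinter> y" "x \<otimes> y"] IB2_tensor deductive_meet_iff closed by auto

lemma le_t_joins:
  assumes "x \<in> carrier B" "y \<in> carrier B"
  shows "x \<sqsubseteq>\<^sub>t x \<squnion> y" "y \<sqsubseteq>\<^sub>t x \<squnion> y"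
  using lattice_onD(4,7)[OF lattice_t] assms unfolding le_t_def by metis+

text \<open>Peirce's law IB3 for \<open>?j\<close> and \<open>y\<close>. Its premise
  \<open>(?j \<rightarrow> y) \<rightarrow> ?j\<close> is a unit, since
  \<open>?j \<rightarrow> y\<close> implies \<open>x \<rightarrow> y\<close>, which lies below
  \<open>?j\<close>.\<close>

lemma excluded_middle:
  assumes xy: "x \<in> carrier B" "y \<in> carrier B"
  shows "x \<squnion> (x \<rightarrow> y) \<in> units"
proof -
  let ?j = "x \<squnion> (x \<rightarrow> y)"
  have c: "x \<rightarrow> y \<in> carrier B" "?j \<in> carrier B" "?j \<rightarrow> y \<in> carrier B"
    "(?j \<rightarrow> y) \<rightarrow> ?j \<in> carrier B"
    using xy closed by auto
  have "(x \<rightarrow> y) \<rightarrow> ?j \<in> units" using le_t_joins(2) le_t_imp_units xy c by blast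
  moreover have "(?j \<rightarrow> y) \<rightarrow> (x \<rightarrow> y) \<in> units"
    using le_t_imp_units le_t_imp_antitone le_t_joins(1) xy c by meson
  ultimately have "(?j \<rightarrow> y) \<rightarrow> ?j \<in> units"
    using units_imp_absorb[of "?j \<rightarrow> y" "x \<rightarrow> y" ?j] units_imp c
      deductive_imp[OF deductive_units] by metis
  moreover have "((?j \<rightarrow> y) \<rightarrow> ?j) \<rightarrow> ?j \<in> units" using IB3 self_imp_units xy c by metis
  ultimately show ?thesis using units_imp c by metis
qed

section \<open>Prime deductive sets\<close>

definition prime :: "'a set \<Rightarrow> bool" where
  "prime D \<longleftrightarrow> deductive D \<and>
     (\<forall>x\<in>carrier B. \<forall>y\<in>carrier B. x \<squnion> y \<in> D \<longrightarrow> x \<in> D \<or> y \<in> D)"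

lemma prime_exists:
  assumes b: "b \<in> carrier B" "b \<notin> units"
  obtains D where "prime D" "b \<notin> D"
proof -
  let ?S = "{D. deductive D \<and> b \<notin> D}"
  have "\<exists>M\<in>?S. \<forall>X\<in>?S. M \<subseteq> X \<longrightarrow> X = M"
  proof (rule subset_Zorn_nonempty)
    show "?S \<noteq> {}" using deductive_units b by blast
  next
    fix C assume ne: "C \<noteq> {}" and ch: "subset.chain ?S C"
    have C: "\<And>X. X \<in> C \<Longrightarrow> deductive X \<and> b \<notin> X" "\<And>X Y. \<lbrakk>X \<in> C; Y \<in> C\<rbrakk> \<Longrightarrow> X \<subseteq> Y \<or> Y \<subseteq> X"
      using ch unfolding subset_chain_def by auto
    have "deductive (\<Union>C)" unfolding deductive_def
    proof (intro conjI ballI impI)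
      show "\<Union>C \<subseteq> carrier B" using C(1) deductive_carrier by blast
      show "units \<subseteq> \<Union>C" using C(1) deductive_unitsD ne by blast
      fix u v assume uv: "u \<in> \<Union>C" "v \<in> carrier B" "u \<rightarrow> v \<in> \<Union>C"
      then obtain X Y where "X \<in> C" "u \<in> X" "Y \<in> C" "u \<rightarrow> v \<in> Y" by blast
      with C(2) obtain Z where Z: "Z \<in> C" "u \<in> Z" "u \<rightarrow> v \<in> Z" by blast
      then have "v \<in> Z" using C(1) deductive_mp uv(2) by blast
      then show "v \<in> \<Union>C" using Z(1) by blast
    qed
    then show "\<Union>C \<in> ?S" using C(1) by auto
  qed
  then obtain D where D: "deductive D" "b \<notin> D"
    and max: "\<And>X. \<lbrakk>deductive X; b \<notin> X; D \<subseteq> X\<rbrakk> \<Longrightarrow> X = D" by auto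
  \<comment> \<open>If \<open>x \<rightarrow> b\<close> were not in \<open>D\<close>, the extension
    \<open>?X\<close> would still avoid \<open>b\<close>; maximality would give
    \<open>?X = D\<close>, although \<open>x\<close> is in \<open>?X\<close>.\<close>
  have out: "x \<rightarrow> b \<in> D" if x: "x \<in> carrier B" "x \<notin> D" for x
  proof (rule ccontr)
    let ?X = "{y \<in> carrier B. x \<rightarrow> y \<in> D}"
    assume "x \<rightarrow> b \<notin> D"
    then have "?X = D"
      using max[OF deductive_extend[OF D(1) x(1)]] deductive_imp[OF D(1)]
        deductive_carrier[OF D(1)] x by auto
    then show False using x self_imp_units deductive_unitsD[OF D(1)] by blast
  qed
  have "prime D"
    unfolding prime_def
  proof (intro conjI ballI impI, fact D(1), rule ccontr)
    fix x y assume xy: "x \<in> carrier B" "y \<in> carrier B" "x \<squnion> y \<in> D" "\<not> (x \<in> D \<or> y \<in> D)"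
    then have "(x \<rightarrow> b) \<sqinter> (y \<rightarrow> b) \<in> D" using out deductive_meet_iff[OF D(1)] b closed by auto
    \<comment> \<open>By IB4 the meet is \<open>(x \<squnion> y) \<rightarrow> b\<close>, so modus
      ponens would put \<open>b\<close> into \<open>D\<close>.\<close>
    then show False using IB4_join deductive_mp[OF D(1)] D(2) xy b by metis
  qed
  then show thesis using D(2) that by blast
qed

lemma prime_join_iff:
  assumes "prime D" "x \<in> carrier B" "y \<in> carrier B"
  shows "x \<squnion> y \<in> D \<longleftrightarrow> x \<in> D \<or> y \<in> D"
proof -
  have "deductive D" using assms(1) by (simp add: prime_def)
  then have "x \<in> D \<or> y \<in> D \<Longrightarrow> x \<squnion> y \<in> D"
    using deductive_up le_t_imp_units le_t_joins assms closed by meson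
  then show ?thesis using assms unfolding prime_def by blast
qed

lemma prime_plus_iff:
  assumes "prime D" "x \<in> carrier B" "y \<in> carrier B"
  shows "x \<oplus> y \<in> D \<longleftrightarrow> x \<in> D \<or> y \<in> D"
proof -
  have "x \<squnion> y \<in> D \<longleftrightarrow> x \<oplus> y \<in> D"
    using assms by (intro deductive_cong) (auto simp: prime_def closed IB4_join IB4_plus)
  then show ?thesis using prime_join_iff assms by blast
qed

lemma prime_imp_iff:
  assumes "prime D" "x \<in> carrier B" "y \<in> carrier B"
  shows "x \<rightarrow> y \<in> D \<longleftrightarrow> (x \<in> D \<longrightarrow> y \<in> D)"
proof -
  have D: "deductive D" using assms(1) by (simp add: prime_def)
  have "x \<in> D \<or> x \<rightarrow> y \<in> D"
    using excluded_middle deductive_unitsD[OF D] prime_join_iff assms closed by metis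
  then show ?thesis using deductive_mp[OF D] deductive_imp[OF D] assms by blast
qed

lemma prime_neg_imp_iff:
  assumes "prime D" "x \<in> carrier B" "y \<in> carrier B"
  shows "\<sim> (x \<rightarrow> y) \<in> D \<longleftrightarrow> x \<in> D \<and> \<sim> y \<in> D"
  using deductive_cong[of D "\<sim> (x \<rightarrow> y)" "x \<sqinter> \<sim> y"] IB6 deductive_meet_iff assms closed
  unfolding prime_def by auto

section \<open>Homomorphisms into \<open>FOUR\<close>\<close>

definition four_of :: "'a set \<Rightarrow> 'a \<Rightarrow> four" where
  "four_of D x = (if x \<in> D then if \<sim> x \<in> D then F_top else F_tt
                  else if \<sim> x \<in> D then F_ff else F_bot)"

lemma four_of_Tr: "four_of D x \<in> Tr \<longleftrightarrow> x \<in> D"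
  by (simp add: four_of_def Tr_def)

text \<open>Each operation of \<open>FOUR\<close> acts on the two bits by Boolean conditions. The
  facts in \<open>iffs\<close> show that membership in \<open>D\<close> of a compound element and of
  its negation obeys the same conditions.\<close>

lemma four_of_hom:
  assumes D: "prime D"
  shows "four_of D \<in> hom B FOUR"
proof -
  have d: "deductive D" using D by (simp add: prime_def)
  note iffs = deductive_meet_iff[OF d] deductive_tensor_iff[OF d] prime_join_iff[OF D]
    prime_plus_iff[OF D] prime_imp_iff[OF D] prime_neg_imp_iff[OF D]
    neg_meet neg_join neg_tensor neg_plus neg_neg
  show ?thesis
    unfolding hom_def
    by (auto simp: four_of_def iffs closed FOUR_def four_le_t_def four_le_k_def Tr_def)
qed

lemma eq_if_units:
  assumes x: "x \<in> carrier B" and y: "y \<in> carrier B"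
    and u: "x \<rightarrow> y \<in> units" "y \<rightarrow> x \<in> units" "\<sim> x \<rightarrow> \<sim> y \<in> units" "\<sim> y \<rightarrow> \<sim> x \<in> units"
  shows "x = y"
proof -
  have *: "a = a \<otimes> b" if a: "a \<in> carrier B" and b: "b \<in> carrier B"
    and ab: "a \<rightarrow> b \<in> units" "\<sim> a \<rightarrow> \<sim> b \<in> units" for a b
  proof -
    have "\<sim> a \<sqsubseteq>\<^sub>t \<sim> (a \<otimes> b)" using units_imp_le_t ab neg_tensor a b closed by metis
    then have "a \<otimes> b \<sqsubseteq>\<^sub>t a" using neg_le_t neg_neg a b closed by metis
    moreover have "a \<sqsubseteq>\<^sub>t a \<otimes> b" using units_imp_le_t ab a b by blast
    ultimately show ?thesis
      unfolding le_t_def using lattice_onD(3)[OF lattice_t] a b closed by metis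
  qed
  show ?thesis using *[OF x y u(1,3)] *[OF y x u(2,4)] lattice_onD(3)[OF lattice_k x y] by simp
qed

text \<open>If \<open>x \<rightarrow> y\<close> is not a unit, some prime \<open>D\<close> omits it,
  hence contains \<open>x\<close> but not \<open>y\<close>; then \<open>four_of D\<close> sends only
  \<open>x\<close> into \<open>Tr\<close>.\<close>

lemma imp_units_if_homs_eq:
  assumes "x \<in> carrier B" "y \<in> carrier B" "\<forall>g\<in>hom B FOUR. g x = g y"
  shows "x \<rightarrow> y \<in> units"
proof (rule ccontr)
  assume "x \<rightarrow> y \<notin> units"
  then obtain D where D: "prime D" "x \<rightarrow> y \<notin> D" using prime_exists closed(5) assms(1,2) by blast
  then have "x \<in> D" "y \<notin> D" using prime_imp_iff assms(1,2) by auto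
  moreover have "four_of D x = four_of D y" using assms(3) four_of_hom[OF D(1)] by blast
  ultimately show False using four_of_Tr by metis
qed

text \<open>Homomorphisms that agree at \<open>x\<close> and \<open>y\<close> agree at their
  negations too, so all four implications are units. Equivalently, \<open>B\<close> embeds into a
  power of \<open>FOUR\<close>.\<close>

theorem hom_FOUR_separates:
  assumes x: "x \<in> carrier B" and y: "y \<in> carrier B" and eq: "\<forall>g\<in>hom B FOUR. g x = g y"
  shows "x = y"
proof -
  have "\<forall>g\<in>hom B FOUR. g (\<sim> x) = g (\<sim> y)" using eq homD(7) x y by metis
  then show ?thesis
    using x y eq closed(6) by (intro eq_if_units imp_units_if_homs_eq) auto
qed

end

section \<open>The variety generated by \<open>FOUR\<close>\<close>

lemma ib_algebra_Fm: "ib_algebra Fm"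
  by unfold_locales (simp_all add: Fm_def)

lemma hom_Fm:
  assumes "h \<in> hom Fm A"
  shows "h p \<in> carrier A"
    "h (Meet p q) = h p \<sqinter>\<^bsub>A\<^esub> h q" "h (Join p q) = h p \<squnion>\<^bsub>A\<^esub> h q"
    "h (Tensor p q) = h p \<otimes>\<^bsub>A\<^esub> h q" "h (Plus p q) = h p \<oplus>\<^bsub>A\<^esub> h q"
    "h (Imp p q) = h p \<rightarrow>\<^bsub>A\<^esub> h q" "h (Neg p) = \<sim>\<^bsub>A\<^esub> h p"
  using homD[OF assms] by (simp_all add: Fm_def)

primrec ev :: "'a ib_algebra \<Rightarrow> (nat \<Rightarrow> 'a) \<Rightarrow> fm \<Rightarrow> 'a" where
  "ev A v (Var n) = v n"
| "ev A v (Meet p q) = ev A v p \<sqinter>\<^bsub>A\<^esub> ev A v q"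
| "ev A v (Join p q) = ev A v p \<squnion>\<^bsub>A\<^esub> ev A v q"
| "ev A v (Tensor p q) = ev A v p \<otimes>\<^bsub>A\<^esub> ev A v q"
| "ev A v (Plus p q) = ev A v p \<oplus>\<^bsub>A\<^esub> ev A v q"
| "ev A v (Imp p q) = ev A v p \<rightarrow>\<^bsub>A\<^esub> ev A v q"
| "ev A v (Neg p) = \<sim>\<^bsub>A\<^esub> ev A v p"

lemma ev_hom:
  assumes A: "ib_algebra A" and v: "range v \<subseteq> carrier A"
  shows "ev A v \<in> hom Fm A"
proof -
  have "ev A v p \<in> carrier A" for p
    by (induction p) (use v ib_algebra_closed[OF A] in auto)
  then show ?thesis by (auto simp: hom_def Fm_def)
qed

text \<open>Four values suffice: the axioms have at most three variables, and compatibility with a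
  binary operation needs four. All variables from index 3 on receive \<open>d\<close>.\<close>

definition asg :: "'a \<Rightarrow> 'a \<Rightarrow> 'a \<Rightarrow> 'a \<Rightarrow> nat \<Rightarrow> 'a" where
  "asg a b c d n = (if n = 0 then a else if n = 1 then b else if n = 2 then c else d)"

lemma ev_asg_hom:
  "\<lbrakk>ib_algebra A; a \<in> carrier A; b \<in> carrier A; c \<in> carrier A; d \<in> carrier A\<rbrakk>
    \<Longrightarrow> ev A (asg a b c d) \<in> hom Fm A"
  by (rule ev_hom) (auto simp: asg_def)

lemma asg_simps [simp]:
  "asg a b c d 0 = a" "asg a b c d (Suc 0) = b" "asg a b c d 2 = c" "asg a b c d 3 = d"
  by (simp_all add: asg_def)

definition FOUR_valid :: "fm \<Rightarrow> fm \<Rightarrow> bool" where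
  "FOUR_valid p q \<longleftrightarrow> (\<forall>h\<in>hom Fm FOUR. h p = h q)"

lemma ib_algebra_FOUR: "ib_algebra FOUR"
  using FOUR_ImpBiLat by (simp add: ImpBiLat_def implicative_bilattice_def)

text \<open>\<open>FOUR\<close> satisfies \<open>E\<close> exactly when \<open>E\<close> lies in the
  set \<open>?T\<close> of all its identities. More equations cut out a smaller class, so the
  intersection is attained at \<open>?T\<close>.\<close>

lemma V_FOUR_iff:
  fixes A :: "'a ib_algebra"
  shows "A \<in> V {FOUR} \<longleftrightarrow> ib_algebra A \<and> (\<forall>p q. FOUR_valid p q \<longrightarrow> (\<forall>h\<in>hom Fm A. h p = h q))"
proof -
  let ?T = "{(p, q). FOUR_valid p q}"
  have gen: "FOUR \<in> equational_class E \<longleftrightarrow> E \<subseteq> ?T" for E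
    using ib_algebra_FOUR unfolding equational_class_def FOUR_valid_def by blast
  have anti: "(equational_class E' :: 'a ib_algebra set) \<subseteq> equational_class E" if "E \<subseteq> E'" for E E'
    using that unfolding equational_class_def by blast
  have "(V {FOUR} :: 'a ib_algebra set) = equational_class ?T" (is "?V = ?C")
  proof
    show "?V \<subseteq> ?C" unfolding V_def using gen by blast
    show "?C \<subseteq> ?V" unfolding V_def
    proof (rule Inter_greatest)
      fix X :: "'a ib_algebra set"
      assume "X \<in> {equational_class E | E. {FOUR} \<subseteq> equational_class E}"
      then obtain E where "X = equational_class E" "E \<subseteq> ?T" using gen by auto
      then show "?C \<subseteq> X" using anti by simp
    qed
  qed
  then show ?thesis by (simp add: equational_class_def)
qed

lemma V_FOUR_identity:
  assumes "FOUR_valid p q" "A \<in> V {FOUR}" "x \<in> carrier A" "y \<in> carrier A" "z \<in> carrier A"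
  shows "ev A (asg x y z z) p = ev A (asg x y z z) q"
  using assms ev_asg_hom[of A x y z z] unfolding V_FOUR_iff by blast

interpretation FOUR: implicative_bilattice FOUR
  using FOUR_ImpBiLat by (simp add: ImpBiLat_def)

lemma carrier_FOUR [simp]: "carrier FOUR = UNIV"
  by (simp add: FOUR_def)

lemma V_FOUR_imp_ImpBiLat:
  assumes A: "A \<in> V {FOUR}"
  shows "A \<in> ImpBiLat"
proof -
  have alg: "ib_algebra A" using A by (simp add: V_FOUR_iff)
  note cl = ib_algebra_closed[OF alg]
  let ?x = "Var 0" and ?y = "Var (Suc 0)" and ?z = "Var 2"
  note lt = lattice_onD[OF FOUR.lattice_t] and lk = lattice_onD[OF FOUR.lattice_k]
  have v:
    "FOUR_valid (Meet ?x ?y) (Meet ?y ?x)"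
    "FOUR_valid (Join ?x ?y) (Join ?y ?x)"
    "FOUR_valid (Meet (Meet ?x ?y) ?z) (Meet ?x (Meet ?y ?z))"
    "FOUR_valid (Join (Join ?x ?y) ?z) (Join ?x (Join ?y ?z))"
    "FOUR_valid (Meet ?x (Join ?x ?y)) ?x"
    "FOUR_valid (Join ?x (Meet ?x ?y)) ?x"
    "FOUR_valid (Tensor ?x ?y) (Tensor ?y ?x)"
    "FOUR_valid (Plus ?x ?y) (Plus ?y ?x)"
    "FOUR_valid (Tensor (Tensor ?x ?y) ?z) (Tensor ?x (Tensor ?y ?z))"
    "FOUR_valid (Plus (Plus ?x ?y) ?z) (Plus ?x (Plus ?y ?z))"
    "FOUR_valid (Tensor ?x (Plus ?x ?y)) ?x"
    "FOUR_valid (Plus ?x (Tensor ?x ?y)) ?x"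
    "FOUR_valid (Neg (Neg ?x)) ?x"
    "FOUR_valid (Imp (Imp ?x ?x) ?y) ?y"
    "FOUR_valid (Imp ?x (Imp ?y ?z)) (Imp (Meet ?x ?y) ?z)"
    "FOUR_valid (Imp (Meet ?x ?y) ?z) (Imp (Tensor ?x ?y) ?z)"
    "FOUR_valid (Imp (Imp (Imp ?x ?y) ?x) ?x) (Imp ?x ?x)"
    "FOUR_valid (Imp (Join ?x ?y) ?z) (Meet (Imp ?x ?z) (Imp ?y ?z))"
    "FOUR_valid (Meet (Imp ?x ?z) (Imp ?y ?z)) (Imp (Plus ?x ?y) ?z)"
    "FOUR_valid (Meet ?x (Imp (Imp ?x ?y) (Tensor ?x ?y))) ?x"
    "FOUR_valid (Imp (Neg (Imp ?x ?y)) ?z) (Imp (Meet ?x (Neg ?y)) ?z)"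
    unfolding FOUR_valid_def
    by (rule ballI, simp only: hom_Fm, (rule lt lk FOUR.neg_neg FOUR.IB1 FOUR.IB2_meet
          FOUR.IB2_tensor FOUR.IB3 FOUR.IB4_join FOUR.IB4_plus FOUR.IB5 FOUR.IB6;
        simp only: carrier_FOUR UNIV_I))+
  \<comment> \<open>The two monotonicity conditions on \<open>\<sim>\<close> as identities.\<close>
  have v_neg:
    "FOUR_valid (Meet (Neg ?y) (Neg (Meet ?y ?x))) (Neg ?y)"
    "FOUR_valid (Tensor (Neg (Tensor ?x ?y)) (Neg ?y)) (Neg (Tensor ?x ?y))"
    unfolding FOUR_valid_def
    by (auto simp: hom_Fm FOUR.neg_meet FOUR.neg_tensor lattice_on_meet_lower[OF FOUR.lattice_k]
        lt(7))
  note e = v[THEN V_FOUR_identity, OF A, simplified] v_neg[THEN V_FOUR_identity, OF A, simplified]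
  have "lattice_on (carrier A) (meet A) (join A)" "lattice_on (carrier A) (tensor A) (plus A)"
    unfolding lattice_on_def using e cl by auto
  moreover have "\<And>x y. \<lbrakk>x \<in> carrier A; y \<in> carrier A; x \<sqsubseteq>\<^sub>t\<^bsub>A\<^esub> y\<rbrakk> \<Longrightarrow> \<sim>\<^bsub>A\<^esub> y \<sqsubseteq>\<^sub>t\<^bsub>A\<^esub> \<sim>\<^bsub>A\<^esub> x"
    "\<And>x y. \<lbrakk>x \<in> carrier A; y \<in> carrier A; x \<sqsubseteq>\<^sub>k\<^bsub>A\<^esub> y\<rbrakk> \<Longrightarrow> \<sim>\<^bsub>A\<^esub> x \<sqsubseteq>\<^sub>k\<^bsub>A\<^esub> \<sim>\<^bsub>A\<^esub> y"
    \<comment> \<open>Substituting \<open>x\<close> for \<open>y \<sqinter> x\<close>, respectively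
      for \<open>x \<otimes> y\<close>, in the two identities on \<open>\<sim>\<close> gives the two
      claims.\<close>
    unfolding le_t_def le_k_def using e(1,22,23) by metis+
  ultimately have "implicative_bilattice A"
    using e by (intro implicative_bilattice.intro alg bilattice.intro
        implicative_bilattice_axioms.intro) auto
  then show ?thesis by (simp add: ImpBiLat_def)
qed

text \<open>An identity failing in \<open>B\<close> under \<open>h\<close> also fails in
  \<open>FOUR\<close>: compose \<open>h\<close> with a homomorphism separating the two
  values.\<close>

theorem ImpBiLat_eq_V_FOUR: "ImpBiLat = V {FOUR}"
proof (intro equalityI subsetI V_FOUR_imp_ImpBiLat)
  fix B :: "'a ib_algebra" assume "B \<in> ImpBiLat"
  then interpret implicative_bilattice B by (simp add: ImpBiLat_def)
  show "B \<in> V {FOUR}"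
    unfolding V_FOUR_iff
  proof (intro conjI allI impI ballI, unfold_locales, rule ccontr)
    fix p q h assume pq: "FOUR_valid p q" and h: "h \<in> hom Fm B" and ne: "h p \<noteq> h q"
    obtain g where g: "g \<in> hom B FOUR" "g (h p) \<noteq> g (h q)"
      using hom_FOUR_separates hom_Fm(1)[OF h] ne by blast
    then show False using hom_comp[OF g(1) h] pq unfolding FOUR_valid_def by fastforce
  qed
qed

section \<open>Reduced models\<close>

text \<open>Defined over any algebra, so that over \<open>Fm\<close> it yields a formula whose value
  under a homomorphism is again an \<open>eqv\<close>.\<close>

definition eqv :: "'a ib_algebra \<Rightarrow> 'a \<Rightarrow> 'a \<Rightarrow> 'a" where
  "eqv A x y = ((x \<rightarrow>\<^bsub>A\<^esub> y) \<sqinter>\<^bsub>A\<^esub> (y \<rightarrow>\<^bsub>A\<^esub> x)) \<sqinter>\<^bsub>A\<^esub>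
     ((\<sim>\<^bsub>A\<^esub> x \<rightarrow>\<^bsub>A\<^esub> \<sim>\<^bsub>A\<^esub> y) \<sqinter>\<^bsub>A\<^esub> (\<sim>\<^bsub>A\<^esub> y \<rightarrow>\<^bsub>A\<^esub> \<sim>\<^bsub>A\<^esub> x))"

lemma eqv_closed:
  "\<lbrakk>ib_algebra A; x \<in> carrier A; y \<in> carrier A\<rbrakk> \<Longrightarrow> eqv A x y \<in> carrier A"
  by (simp add: eqv_def ib_algebra_closed)

lemma hom_eqv:
  assumes "h \<in> hom A B" "ib_algebra A" "x \<in> carrier A" "y \<in> carrier A"
  shows "h (eqv A x y) = eqv B (h x) (h y)"
  using assms by (simp add: eqv_def homD[OF assms(1)] ib_algebra_closed)

lemma hom_Fm_eqv: "h \<in> hom Fm A \<Longrightarrow> h (eqv Fm p q) = eqv A (h p) (h q)"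
  using hom_eqv[of h Fm A p q] ib_algebra_Fm by (simp add: Fm_def)

text \<open>An element of \<open>FOUR\<close> is determined by whether it and its negation lie in
  \<open>Tr\<close>, and the four implications compare exactly these two bits.\<close>

lemma eqv_FOUR: "eqv FOUR x y \<in> Tr \<longleftrightarrow> x = y"
  by (cases x; cases y; simp add: eqv_def FOUR_def Tr_def four_le_t_def)

lemma congruence_eqv:
  assumes "congruence A \<theta>" "(a, b) \<in> \<theta>" "(c, d) \<in> \<theta>"
  shows "(eqv A a c, eqv A b d) \<in> \<theta>"
  using assms unfolding congruence_def eqv_def by auto

lemma LB_modelD:
  "\<lbrakk>LB_model A F; \<Gamma> \<turnstile>\<^sub>L\<^sub>B \<phi>; h \<in> hom Fm A; h ` \<Gamma> \<subseteq> F\<rbrakk> \<Longrightarrow> h \<phi> \<in> F"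
  by (auto simp: LB_model_def)

text \<open>In a model of the logic this is the Leibniz congruence of \<open>F\<close>.\<close>

definition eqv_rel :: "'a ib_algebra \<Rightarrow> 'a set \<Rightarrow> ('a \<times> 'a) set" where
  "eqv_rel A F = {(a, b). a \<in> carrier A \<and> b \<in> carrier A \<and> eqv A a b \<in> F}"

text \<open>Each condition on a compatible congruence becomes an entailment between
  \<open>eqv\<close> formulas. It is valid because in \<open>FOUR\<close> these formulas express
  equality, and a model inherits it.\<close>

lemma compatible_eqv_rel:
  assumes M: "LB_model A F"
  shows "compatible_congruence A F (eqv_rel A F)"
proof -
  have A: "ib_algebra A" and F: "F \<subseteq> carrier A"
    using M by (auto simp: LB_model_def is_matrix_def)
  note cl = ib_algebra_closed[OF A]
  let ?a = "Var 0" and ?b = "Var (Suc 0)" and ?c = "Var 2" and ?d = "Var 3"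
  let ?E = "eqv Fm"
  have rule: "ev A (asg a b c d) \<phi> \<in> F"
    if "\<Gamma> \<turnstile>\<^sub>L\<^sub>B \<phi>" "a \<in> carrier A" "b \<in> carrier A" "c \<in> carrier A" "d \<in> carrier A"
      "ev A (asg a b c d) ` \<Gamma> \<subseteq> F" for \<Gamma> \<phi> a b c d
    using LB_modelD[OF M that(1) ev_asg_hom[OF A that(2-5)] that(6)] .
  have ev_eqv: "ev A (asg a b c d) (?E p q)
      = eqv A (ev A (asg a b c d) p) (ev A (asg a b c d) q)"
    if "a \<in> carrier A" "b \<in> carrier A" "c \<in> carrier A" "d \<in> carrier A" for a b c d p q
    using hom_Fm_eqv ev_asg_hom[OF A that] .
  note LB = LB_entails_def hom_Fm_eqv hom_Fm eqv_FOUR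
  have refl: "eqv A a a \<in> F" if "a \<in> carrier A" for a
    using rule[of "{}" "?E ?a ?a" a a a a] that by (auto simp: ev_eqv LB)
  have sym: "eqv A b a \<in> F" if "a \<in> carrier A" "b \<in> carrier A" "eqv A a b \<in> F" for a b
    using rule[of "{?E ?a ?b}" "?E ?b ?a" a b b b] that by (auto simp: ev_eqv LB)
  have trans: "eqv A a c \<in> F"
    if "a \<in> carrier A" "b \<in> carrier A" "c \<in> carrier A" "eqv A a b \<in> F" "eqv A b c \<in> F" for a b c
    using rule[of "{?E ?a ?b, ?E ?b ?c}" "?E ?a ?c" a b c c] that by (auto simp: ev_eqv LB)
  have neg: "eqv A (\<sim>\<^bsub>A\<^esub> a) (\<sim>\<^bsub>A\<^esub> b) \<in> F"
    if "a \<in> carrier A" "b \<in> carrier A" "eqv A a b \<in> F" for a b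
    using rule[of "{?E ?a ?b}" "?E (Neg ?a) (Neg ?b)" a b b b] that by (auto simp: ev_eqv LB)
  have compat: "b \<in> F" if "a \<in> carrier A" "b \<in> carrier A" "eqv A a b \<in> F" "a \<in> F" for a b
  proof -
    have "{?E ?a ?b, ?a} \<turnstile>\<^sub>L\<^sub>B ?b" by (auto simp: LB)
    then show ?thesis using rule[of "{?E ?a ?b, ?a}" ?b a b b b] that by (simp add: ev_eqv)
  qed
  have ops: "eqv A (a \<sqinter>\<^bsub>A\<^esub> c) (b \<sqinter>\<^bsub>A\<^esub> d) \<in> F" "eqv A (a \<squnion>\<^bsub>A\<^esub> c) (b \<squnion>\<^bsub>A\<^esub> d) \<in> F"
    "eqv A (a \<otimes>\<^bsub>A\<^esub> c) (b \<otimes>\<^bsub>A\<^esub> d) \<in> F" "eqv A (a \<oplus>\<^bsub>A\<^esub> c) (b \<oplus>\<^bsub>A\<^esub> d) \<in> F"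
    "eqv A (a \<rightarrow>\<^bsub>A\<^esub> c) (b \<rightarrow>\<^bsub>A\<^esub> d) \<in> F"
    if "a \<in> carrier A" "b \<in> carrier A" "c \<in> carrier A" "d \<in> carrier A"
      "eqv A a b \<in> F" "eqv A c d \<in> F" for a b c d
    using that rule[of "{?E ?a ?b, ?E ?c ?d}" "?E (Meet ?a ?c) (Meet ?b ?d)" a b c d]
      rule[of "{?E ?a ?b, ?E ?c ?d}" "?E (Join ?a ?c) (Join ?b ?d)" a b c d]
      rule[of "{?E ?a ?b, ?E ?c ?d}" "?E (Tensor ?a ?c) (Tensor ?b ?d)" a b c d]
      rule[of "{?E ?a ?b, ?E ?c ?d}" "?E (Plus ?a ?c) (Plus ?b ?d)" a b c d]
      rule[of "{?E ?a ?b, ?E ?c ?d}" "?E (Imp ?a ?c) (Imp ?b ?d)" a b c d]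
    by (auto simp: ev_eqv LB)
  have "equiv (carrier A) (eqv_rel A F)"
    by (rule equivI)
      (auto simp: eqv_rel_def refl_on_def intro!: refl intro: symI transI sym trans)
  then have "congruence A (eqv_rel A F)"
    unfolding congruence_def using cl neg ops by (auto simp: eqv_rel_def)
  then show ?thesis
    unfolding compatible_congruence_def using compat sym by (auto simp: eqv_rel_def)
qed

text \<open>An identity of \<open>FOUR\<close> makes the corresponding \<open>eqv\<close> formula a
  theorem of the logic, so its two sides have related values; in a reduced model they are
  equal.\<close>

lemma Alg_star_LB_subset_V_FOUR: "Alg_star_LB \<subseteq> V {FOUR}"
proof
  fix A :: "'a ib_algebra" assume "A \<in> Alg_star_LB"
  then obtain F where M: "LB_model A F" and red: "reduced A F" by (auto simp: Alg_star_LB_def)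
  have A: "ib_algebra A" using M by (simp add: LB_model_def is_matrix_def)
  show "A \<in> V {FOUR}"
    unfolding V_FOUR_iff
  proof (intro conjI allI impI ballI, fact A)
    fix p q h assume pq: "FOUR_valid p q" and h: "h \<in> hom Fm A"
    have "{} \<turnstile>\<^sub>L\<^sub>B eqv Fm p q"
      using pq by (auto simp: LB_entails_def hom_Fm_eqv eqv_FOUR FOUR_valid_def)
    then have "h (eqv Fm p q) \<in> F" using LB_modelD[OF M _ h] by auto
    then have "(h p, h q) \<in> eqv_rel A F"
      using h by (simp add: eqv_rel_def hom_Fm_eqv hom_Fm(1))
    moreover have "eqv_rel A F \<subseteq> Id_on (carrier A)"
      using red compatible_eqv_rel[OF M]
      unfolding reduced_def greatest_compatible_congruence_def by blast
    ultimately show "h p = h q" by auto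
  qed
qed

lemma ImpBiLat_subset_Alg_star_LB: "ImpBiLat \<subseteq> Alg_star_LB"
proof
  fix B :: "'a ib_algebra" assume "B \<in> ImpBiLat"
  then interpret implicative_bilattice B by (simp add: ImpBiLat_def)
  have alg: "ib_algebra B" by unfold_locales
  \<comment> \<open>As the intersection of all preimages of \<open>Tr\<close>, this set inherits
    every entailment, and separation makes \<open>eqv\<close> test equality relative to it.\<close>
  define F where "F = {x \<in> carrier B. \<forall>g\<in>hom B FOUR. g x \<in> Tr}"
  have M: "LB_model B F"
    unfolding LB_model_def is_matrix_def
  proof (intro conjI allI impI ballI, fact alg)
    show "F \<subseteq> carrier B" by (auto simp: F_def)
    fix \<Gamma> \<phi> h assume ent: "\<Gamma> \<turnstile>\<^sub>L\<^sub>B \<phi>" and h: "h \<in> hom Fm B" and sub: "h ` \<Gamma> \<subseteq> F"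
    have "g (h \<phi>) \<in> Tr" if "g \<in> hom B FOUR" for g
    proof -
      have "(g \<circ> h) ` \<Gamma> \<subseteq> Tr" using sub that by (auto simp: F_def)
      then show ?thesis using ent hom_comp[OF that h] unfolding LB_entails_def by fastforce
    qed
    then show "h \<phi> \<in> F" using hom_Fm(1)[OF h] by (simp add: F_def)
  qed
  have eqv_F: "eqv B x y \<in> F \<longleftrightarrow> x = y" if "x \<in> carrier B" "y \<in> carrier B" for x y
    using that eqv_closed[OF alg that] hom_FOUR_separates[OF that]
    by (auto simp: F_def hom_eqv[OF _ alg] eqv_FOUR)
  have "compatible_congruence B F (Id_on (carrier B))"
  proof -
    have "Id_on (carrier B) = eqv_rel B F" using eqv_F by (auto simp: eqv_rel_def Id_on_def)
    then show ?thesis using compatible_eqv_rel[OF M] by simp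
  qed
  moreover have "\<theta> \<subseteq> Id_on (carrier B)" if \<theta>: "compatible_congruence B F \<theta>" for \<theta>
  proof
    fix z assume z: "z \<in> \<theta>"
    have con: "congruence B \<theta>" and eq: "equiv (carrier B) \<theta>"
      using \<theta> by (auto simp: compatible_congruence_def congruence_def)
    obtain a b where ab: "z = (a, b)" "a \<in> carrier B" "b \<in> carrier B"
      using z eq equiv_type by blast
    \<comment> \<open>Pairing with \<open>(a, a)\<close> relates \<open>eqv B a a\<close>, which is
      in \<open>F\<close>, to \<open>eqv B a b\<close>; compatibility then forces
      \<open>a = b\<close>.\<close>
    have "(a, a) \<in> \<theta>" using eq ab(2) unfolding equiv_def refl_on_def by blast
    then have "(eqv B a a, eqv B a b) \<in> \<theta>" using congruence_eqv[OF con] z ab by blast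
    then have "eqv B a b \<in> F"
      using \<theta> eqv_F ab unfolding compatible_congruence_def by blast
    then show "z \<in> Id_on (carrier B)" using eqv_F ab by auto
  qed
  ultimately have "reduced B F"
    by (simp add: reduced_def greatest_compatible_congruence_def)
  then show "B \<in> Alg_star_LB" using M by (auto simp: Alg_star_LB_def)
qed

theorem theorem5p2p1:
  "(ImpBiLat :: 'a ib_algebra set) = V {FOUR} \<and>
   (Alg_star_LB :: 'a ib_algebra set) = V {FOUR}"
  using ImpBiLat_eq_V_FOUR Alg_star_LB_subset_V_FOUR ImpBiLat_subset_Alg_star_LB by blast

end
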